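(* Let $\varrho_F'$ be the substitution ${\tt a}\mapsto{\tt b}{\tt a},\ {\tt b}\mapsto{\tt a}$ and ${\tt f}$ the Fibonacci word. Then the one-sided fixed points of $(\varrho_F')^2$ starting with ${\tt a}$ and with ${\tt b}$ exist, and \[\lim_{n\to\infty}(\varrho_F')^{2n}({\tt a})={\tt a}{\tt b}{\tt f},\qquad \lim_{n\to\infty}(\varrho_F')^{2n}({\tt b})={\tt b}{\tt a}{\tt f}.\] Moreover, $r_{{\tt a}{\tt b}{\tt f}}(1)=1$, $r_{{\tt b}{\tt a}{\tt f}}(1)=-1$, and $r_{{\tt a}{\tt b}{\tt f}}(n)=r_{{\tt b}{\tt a}{\tt f}}(n)=n-1$ for all $n>1$.
   Context: The Fibonacci word ${\tt f}={\tt a}{\tt b}{\tt a}{\tt a}{\tt b}\cdots$ is the fixed point of $\varrho_F:{\tt a}\mapsto{\tt a}{\tt b},\ {\tt b}\mapsto{\tt a}$; ${\tt a}{\tt b}{\tt f}$ denotes ${\tt f}$ with prefix ${\tt a}{\tt b}$ attached. Words are indexed from position $0$; for a word in which both letters occur infinitely often, $p_{\tt a}(n)$, $p_{\tt b}(n)$ are the positions of the $n$-th ${\tt a}$ and $n$-th ${\tt b}$ and $r(n)=p_{\tt b}(n)-p_{\tt a}(n)$. *)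

theory Defs
  imports Complex_Main "HOL-Library.Stream" "HOL-Library.Infinite_Set"
begin

datatype letter = La | Lb

definition subst_word :: "('a \<Rightarrow> 'a list) \<Rightarrow> 'a list \<Rightarrow> 'a list" where
  "subst_word \<sigma> u = concat (map \<sigma> u)"

text \<open>Only meaningful for non-erasing substitutions, since \<^const>\<open>flat\<close> requires non-empty blocks.\<close>

definition subst_stream :: "('a \<Rightarrow> 'a list) \<Rightarrow> 'a stream \<Rightarrow> 'a stream" where
  "subst_stream \<sigma> w = flat (smap \<sigma> w)"

fun rhoF :: "letter \<Rightarrow> letter list" where
  "rhoF La = [La, Lb]"
| "rhoF Lb = [La]"

fun rhoF' :: "letter \<Rightarrow> letter list" where
  "rhoF' La = [Lb, La]"
| "rhoF' Lb = [La]"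

text \<open>Well-defined by \<open>fib_word_ex1\<close> below.\<close>

definition fib_word :: "letter stream" where
  "fib_word = (THE w. subst_stream rhoF w = w)"

text \<open>Convergence of finite words to an infinite word, in the usual prefix topology.  As
  \<^term>\<open>stake k w\<close> has length \<^term>\<open>k\<close>, the lengths of the \<open>u n\<close> tend to infinity.\<close>

definition word_tendsto :: "(nat \<Rightarrow> 'a list) \<Rightarrow> 'a stream \<Rightarrow> bool" where
  "word_tendsto u w \<longleftrightarrow> (\<forall>k. \<forall>\<^sub>F n in sequentially. take k (u n) = stake k w)"

text \<open>Positions start at 0, occurrences are counted from 1, so \<open>n\<close> is meant to be positive, and the
  letter \<open>x\<close> to occur infinitely often in \<open>w\<close>; for the words of interest see
  \<open>infinite_letter_fib_word\<close> below.\<close>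

definition letter_pos :: "'a \<Rightarrow> 'a stream \<Rightarrow> nat \<Rightarrow> nat" where
  "letter_pos x w n = enumerate {i. w !! i = x} (n - 1)"

definition rdiff :: "letter stream \<Rightarrow> nat \<Rightarrow> int" where
  "rdiff w n = int (letter_pos Lb w n) - int (letter_pos La w n)"

lemma subst_word_append: "subst_word \<sigma> (u @ v) = subst_word \<sigma> u @ subst_word \<sigma> v"
  by (simp add: subst_word_def)

lemma subst_stream_shift:
  assumes "\<And>x. \<sigma> x \<noteq> []"
  shows "subst_stream \<sigma> (u @- w) = subst_word \<sigma> u @- subst_stream \<sigma> w"
  using assms by (induction u) (auto simp: subst_stream_def subst_word_def)

lemma rhoF_nonempty: "rhoF x \<noteq> []"
  by (cases x) auto

lemma stream_eq_if_stake_eq: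
  assumes "\<And>n. \<exists>k\<ge>n. stake k v = stake k w"
  shows "v = w"
proof -
  have "v !! i = w !! i" for i
  proof -
    from assms[of "Suc i"] obtain k where "k \<ge> Suc i" "stake k v = stake k w" by blast
    then show ?thesis by (metis Suc_le_eq stake_nth)
  qed
  then show ?thesis by (metis smap_alt stream.map_ident)
qed

lemma fib_word_ex1: "\<exists>!w. subst_stream rhoF w = w"
proof -
  define u where "u n = (subst_word rhoF ^^ n) [La]" for n
  have u0: "u 0 = [La]" and uS: "u (Suc n) = subst_word rhoF (u n)" for n
    by (simp_all add: u_def)
  have step: "\<exists>v. v \<noteq> [] \<and> u (Suc n) = u n @ v" for n
  proof (induction n)
    case 0
    show ?case by (simp add: uS u0 subst_word_def)
  next
    case (Suc n)
    then obtain v where v: "v \<noteq> []" "u (Suc n) = u n @ v" by blast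
    have "u (Suc (Suc n)) = u (Suc n) @ subst_word rhoF v"
      using v(2) by (metis uS subst_word_append)
    moreover have "subst_word rhoF v \<noteq> []"
      using v(1) rhoF_nonempty by (cases v) (auto simp: subst_word_def)
    ultimately show ?case by blast
  qed
  have len: "n < length (u n)" for n
  proof (induction n)
    case (Suc n)
    from step[of n] obtain v where "v \<noteq> []" "u (Suc n) = u n @ v" by blast
    with Suc show ?case by (cases v) auto
  qed (simp add: u0)
  have pre: "\<exists>v. u (n + k) = u n @ v" for n k
  proof (induction k)
    case (Suc k)
    then show ?case using step[of "n + k"] by (metis add_Suc_right append_assoc)
  qed simp
  have nth: "u m ! i = u n ! i" if "i < length (u m)" "i < length (u n)" for m n i
    using that pre[of m "n - m"] pre[of n "m - n"]
    by (cases "m \<le> n") (auto simp: nth_append)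
  define w where "w = smap (\<lambda>i. u i ! i) nats"
  have wn: "w !! i = u i ! i" for i by (simp add: w_def)
  have stw: "stake (length (u n)) w = u n" for n
    by (rule nth_equalityI) (auto simp: wn intro!: nth len)
  have dec: "w = u n @- sdrop (length (u n)) w" for n
    by (metis stw stake_sdrop)
  have "subst_stream rhoF w = w"
  proof (rule stream_eq_if_stake_eq)
    fix n
    have "subst_stream rhoF w = u (Suc n) @- subst_stream rhoF (sdrop (length (u n)) w)"
      by (metis dec subst_stream_shift[of rhoF] rhoF_nonempty uS)
    then have "stake (length (u (Suc n))) (subst_stream rhoF w) = u (Suc n)"
      by (simp add: stake_shift)
    moreover have "n \<le> length (u (Suc n))" using len[of "Suc n"] by simp
    ultimately show "\<exists>k\<ge>n. stake k (subst_stream rhoF w) = stake k w"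
      using stw by metis
  qed
  moreover have "v = w" if v: "subst_stream rhoF v = v" for v
  proof (rule stream_eq_if_stake_eq)
    have "shd v = La"
    proof -
      have "shd (subst_stream rhoF v) = La"
        by (cases "shd v") (auto simp: subst_stream_def)
      then show ?thesis using v by simp
    qed
    then have "\<exists>t. v = u n @- t" for n
    proof (induction n)
      case 0
      then show ?case by (metis u0 shift.simps stream.collapse)
    next
      case (Suc n)
      then obtain t where "v = u n @- t" by blast
      then show ?case
        by (metis v subst_stream_shift[of rhoF] rhoF_nonempty uS)
    qed
    then have *: "stake (length (u n)) v = u n" for n
      by (metis append.right_neutral cancel_comm_monoid_add_class.diff_cancel stake.simps(1)
          stake_shift take_all order_refl)
    fix n
    show "\<exists>k\<ge>n. stake k v = stake k w"
      using * stw len[of n] by (metis less_imp_le)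
  qed
  ultimately show ?thesis by blast
qed

lemma fib_word_fixed: "subst_stream rhoF fib_word = fib_word"
  unfolding fib_word_def by (rule theI'[OF fib_word_ex1])

lemma infinite_letter_fib_word: "infinite {i. (u @- fib_word) !! i = x}"
proof -
  let ?S = "subst_word rhoF" and ?T = "subst_stream rhoF"
  have len: "length v \<le> length (?S v)" for v
  proof (induction v)
    case (Cons y v)
    then show ?case by (cases y) (auto simp: subst_word_def)
  qed (simp add: subst_word_def)
  have "\<exists>i\<ge>n. (u @- fib_word) !! i = x" for n
  proof -
    define v t where "v = ?S (?S (stake n fib_word))" and "t = ?T (?T (sdrop n fib_word))"
    have eq: "fib_word = v @- t"
      unfolding v_def t_def
      by (metis fib_word_fixed stake_sdrop subst_stream_shift[of rhoF] rhoF_nonempty)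
    have "t !! 0 = La" "t !! 1 = Lb"
      by (cases "sdrop n fib_word"; cases "shd (sdrop n fib_word)";
          cases "shd (stl (sdrop n fib_word))"; simp add: t_def subst_stream_def flat_unfold)+
    then obtain j where "t !! j = x" by (metis letter.exhaust)
    then have "fib_word !! (length v + j) = x"
      by (subst eq) (simp add: shift_snth_ge)
    moreover have "n \<le> length v"
      unfolding v_def by (metis len length_stake order_trans)
    ultimately show ?thesis
      by (intro exI[of _ "length u + length v + j"]) (auto simp: shift_snth_ge)
  qed
  then show ?thesis by (auto simp: infinite_nat_iff_unbounded_le)
qed

end

theory Submission
  imports Defs
begin

text \<open>For infinite words, \<open>\<rho>\<^sub>F(w) = a \<rho>\<^sub>F'(w)\<close>. Applied twice to \<open>f = \<rho>\<^sub>F(f)\<close> this gives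
  \<open>f = aba (\<rho>\<^sub>F')\<^sup>2(f)\<close>, whence \<open>abf\<close> and \<open>baf\<close> are fixed by \<open>(\<rho>\<^sub>F')\<^sup>2\<close>. A fixed word is the limit
  of the iterates of its first letter, because \<open>(\<rho>\<^sub>F')\<^sup>2\<close> at least doubles lengths.

  The letters \<open>b\<close> of \<open>f\<close> are exactly the second letters of the blocks \<open>\<rho>\<^sub>F(a) = ab\<close>. If the \<open>n\<close>-th
  \<open>a\<close> is at position \<open>i\<close>, then the prefix of length \<open>i\<close> has an image of length \<open>i + (n - 1)\<close>, so the
  \<open>n\<close>-th \<open>b\<close> is at position \<open>i + n\<close>.\<close>

lemma rhoF'_nonempty: "rhoF' x \<noteq> []"
  by (cases x) auto

lemma subst_stream_SCons:
  assumes "\<And>x. \<sigma> x \<noteq> []"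
  shows "subst_stream \<sigma> (x ## w) = \<sigma> x @- subst_stream \<sigma> w"
  using subst_stream_shift[OF assms, where u = "[x]"] by (simp add: subst_word_def)

text \<open>Blockwise \<open>rhoF x @ [La] = La # rhoF' x\<close>, so an \<open>La\<close> can be
  moved through the image of any finite prefix.\<close>

lemma subst_stream_rhoF_conj_rhoF': "subst_stream rhoF w = La ## subst_stream rhoF' w"
proof -
  have word: "subst_word rhoF u @ [La] = La # subst_word rhoF' u" for u
  proof (induction u)
    case (Cons x u)
    then show ?case by (cases x) (simp_all add: subst_word_def)
  qed (simp add: subst_word_def)
  have len: "length u \<le> length (subst_word rhoF u)" for u
  proof (induction u)
    case (Cons x u)
    then show ?case by (cases x) (simp_all add: subst_word_def)
  qed simp
  show ?thesis
  proof (rule stream_eq_if_stake_eq)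
    fix n
    let ?u = "stake n w" and ?t = "sdrop n w"
    \<comment> \<open>All blocks of \<open>rhoF\<close> begin with \<open>La\<close>, so the image
      of the tail supplies the trailing \<open>La\<close> that \<open>word\<close> requires.\<close>
    have "shd (subst_stream rhoF ?t) = La"
      by (cases ?t; cases "shd ?t") (simp_all add: subst_stream_SCons rhoF_nonempty)
    then obtain t where t: "subst_stream rhoF ?t = La ## t"
      by (metis stream.collapse)
    have "subst_stream rhoF w = subst_word rhoF ?u @- subst_stream rhoF ?t"
      by (metis stake_sdrop subst_stream_shift[of rhoF] rhoF_nonempty)
    also have "\<dots> = (subst_word rhoF ?u @ [La]) @- t"
      by (simp add: t)
    finally have F: "subst_stream rhoF w = (La # subst_word rhoF' ?u) @- t"
      by (simp only: word)
    have "subst_stream rhoF' w = subst_word rhoF' ?u @- subst_stream rhoF' ?t"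
      by (metis stake_sdrop subst_stream_shift[of rhoF'] rhoF'_nonempty)
    then have F': "La ## subst_stream rhoF' w
        = (La # subst_word rhoF' ?u) @- subst_stream rhoF' ?t"
      by simp
    let ?k = "length (La # subst_word rhoF' ?u)"
    \<comment> \<open>By \<open>word\<close> both substitutions give \<open>?u\<close> equally long
      images, so the common prefix has length at least \<open>n\<close>.\<close>
    have "n \<le> ?k"
      using len[of ?u] arg_cong[OF word[of ?u], of length] by simp
    moreover have "stake ?k (subst_stream rhoF w) = stake ?k (La ## subst_stream rhoF' w)"
      unfolding F F' by (simp only: stake_shift) simp
    ultimately show "\<exists>k\<ge>n. stake k (subst_stream rhoF w)
        = stake k (La ## subst_stream rhoF' w)"
      by blast
  qed
qed

lemma fib_word_rhoF'_sq:
  "fib_word = [La, Lb, La] @- subst_stream rhoF' (subst_stream rhoF' fib_word)"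
proof -
  have f: "fib_word = La ## subst_stream rhoF' fib_word"
    using fib_word_fixed subst_stream_rhoF_conj_rhoF' by metis
  then have "subst_stream rhoF' fib_word
      = subst_stream rhoF' (La ## subst_stream rhoF' fib_word)"
    by (rule arg_cong)
  then have "subst_stream rhoF' fib_word
      = [Lb, La] @- subst_stream rhoF' (subst_stream rhoF' fib_word)"
    by (simp add: subst_stream_SCons rhoF'_nonempty)
  with f show ?thesis by (metis shift.simps)
qed

text \<open>The square sends a to aba and b to ba, hence ab to ab.aba and ba to ba.aba; the extra
  aba followed by the image of f is f again.\<close>

lemma rhoF'_sq_fixes_ab_fib: "(subst_stream rhoF' ^^ 2) ([La, Lb] @- fib_word) = [La, Lb] @- fib_word"
  and rhoF'_sq_fixes_ba_fib: "(subst_stream rhoF' ^^ 2) ([Lb, La] @- fib_word) = [Lb, La] @- fib_word"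
  by (simp_all add: numeral_2_eq_2 subst_stream_SCons rhoF'_nonempty
      fib_word_rhoF'_sq[symmetric, simplified])

text \<open>The blocks of the square are aba and ba. Squaring matters here: \<open>rhoF'\<close>
  alone does not lengthen \<open>Lb\<close>.\<close>

lemma length_rhoF'_sq: "2 * length u \<le> length ((subst_word rhoF' ^^ 2) u)"
proof (induction u)
  case (Cons x u)
  then show ?case by (cases x) (simp_all add: numeral_2_eq_2 subst_word_def)
qed simp

lemma rhoF'_sq_fixed_limit:
  assumes "(subst_stream rhoF' ^^ 2) w = w"
  shows "word_tendsto (\<lambda>n. (subst_word rhoF' ^^ (2 * n)) [shd w]) w"
proof -
  define u where "u n = (subst_word rhoF' ^^ (2 * n)) [shd w]" for n
  have uS: "u (Suc n) = (subst_word rhoF' ^^ 2) (u n)" for n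
    by (simp add: u_def numeral_2_eq_2)
  \<comment> \<open>The square maps a prefix of a fixed word to a prefix of the same word.\<close>
  have prefix: "\<exists>t. w = u n @- t" for n
  proof (induction n)
    case 0
    then show ?case by (intro exI[of _ "stl w"]) (simp add: u_def)
  next
    case (Suc n)
    then obtain t where "w = u n @- t" by blast
    then have "w = (subst_stream rhoF' ^^ 2) (u n @- t)"
      using assms by simp
    also have "\<dots> = u (Suc n) @- (subst_stream rhoF' ^^ 2) t"
      by (simp add: uS numeral_2_eq_2 subst_stream_shift rhoF'_nonempty)
    finally show ?case ..
  qed
  have len: "n < length (u n)" for n
  proof (induction n)
    case (Suc n)
    then show ?case using length_rhoF'_sq[of "u n"] by (simp add: uS)
  qed (simp add: u_def)
  have "take k (u n) = stake k w" if "k \<le> n" for k n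
  proof -
    obtain t where "w = u n @- t" using prefix by blast
    moreover have "k \<le> length (u n)" using len[of n] that by simp
    ultimately show ?thesis by (simp add: stake_shift)
  qed
  then have "word_tendsto u w"
    unfolding word_tendsto_def eventually_sequentially by blast
  then show ?thesis by (simp add: u_def[abs_def])
qed

lemma word_tendsto_unique:
  assumes "word_tendsto u v" "word_tendsto u w"
  shows "v = w"
proof (rule stream_eq_if_stake_eq)
  fix n
  have "\<forall>\<^sub>F m in sequentially. take n (u m) = stake n v \<and> take n (u m) = stake n w"
    using assms by (simp add: word_tendsto_def eventually_conj)
  then have "stake n v = stake n w"
    by (auto simp: eventually_sequentially)
  then show "\<exists>k\<ge>n. stake k v = stake k w" by blast
qed

text \<open>Both words are limits of the same sequence, the iterates of their common first
  letter.\<close>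

lemma rhoF'_sq_fixed_unique:
  assumes "(subst_stream rhoF' ^^ 2) v = v" "(subst_stream rhoF' ^^ 2) w = w" "shd v = shd w"
  shows "v = w"
  using word_tendsto_unique[OF rhoF'_sq_fixed_limit[OF assms(1)]] rhoF'_sq_fixed_limit[OF assms(2)]
  by (simp add: assms(3))

text \<open>As \<open>enumerate\<close> is increasing and starts at index 0, an index counts the
  smaller elements. This turns positions into letter counts of prefixes.\<close>

lemma card_below_enumerate:
  fixes S :: "nat set"
  assumes "infinite S"
  shows "card {j \<in> S. j < enumerate S n} = n"
proof -
  have "{j \<in> S. j < enumerate S n} = enumerate S ` {..<n}"
  proof (intro equalityI subsetI)
    fix j
    assume j: "j \<in> {j \<in> S. j < enumerate S n}"
    then obtain m where "enumerate S m = j"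
      using enumerate_Ex[OF assms] by blast
    then show "j \<in> enumerate S ` {..<n}"
      using j enumerate_mono_iff[OF assms, of m n] by auto
  qed (use enumerate_in_set[OF assms] enumerate_mono_iff[OF assms] in auto)
  moreover have "inj_on (enumerate S) {..<n}"
    by (rule strict_mono_imp_inj_on[OF strict_mono_enumerate[OF assms]])
  ultimately show ?thesis by (simp add: card_image)
qed

lemma count_list_stake: "count_list (stake i w) x = card {j. w !! j = x \<and> j < i}"
proof (induction i)
  case (Suc i)
  have "{j. w !! j = x \<and> j < Suc i}
      = (if w !! i = x then insert i {j. w !! j = x \<and> j < i} else {j. w !! j = x \<and> j < i})"
    by (auto simp: less_Suc_eq)
  then show ?case using Suc by (simp add: stake_Suc del: stake.simps)
qed simp

text \<open>Occurrences are numbered from 1, so \<open>Suc\<close> adds the one at \<open>i\<close>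
  itself to those before it.\<close>

lemma letter_pos_eqI:
  assumes inf: "infinite {i. w !! i = x}"
    and x: "w !! i = x" and count: "Suc (count_list (stake i w) x) = n"
  shows "letter_pos x w n = i"
proof -
  obtain m where m: "enumerate {i. w !! i = x} m = i"
    using enumerate_Ex[OF inf] x by blast
  have "m = count_list (stake i w) x"
    using card_below_enumerate[OF inf, of m] by (simp add: m count_list_stake)
  then show ?thesis using m count by (auto simp: letter_pos_def)
qed

lemma ex_letter_pos:
  assumes "infinite {i. w !! i = x}"
  obtains i where "w !! i = x" "count_list (stake i w) x = n"
  using card_below_enumerate[OF assms, of n] enumerate_in_set[OF assms, of n]
  by (auto simp: count_list_stake)

text \<open>The block of \<open>La\<close> has one letter more than that of \<open>Lb\<close>. This
  surplus letter is the only \<open>Lb\<close> in any block, which also gives the next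
  count.\<close>

lemma length_subst_rhoF: "length (subst_word rhoF u) = length u + count_list u La"
proof (induction u)
  case (Cons x u)
  then show ?case by (cases x) (simp_all add: subst_word_def)
qed (simp add: subst_word_def)

lemma count_b_subst_rhoF: "count_list (subst_word rhoF u) Lb = count_list u La"
proof (induction u)
  case (Cons x u)
  then show ?case by (cases x) (simp_all add: subst_word_def)
qed (simp add: subst_word_def)

lemma fib_word_b_from_a:
  assumes i: "fib_word !! i = La"
  defines "k \<equiv> Suc (i + count_list (stake i fib_word) La)"
  shows "fib_word !! k = Lb" "count_list (stake k fib_word) Lb = count_list (stake i fib_word) La"
proof -
  let ?u = "stake i fib_word"
  have "fib_word = ?u @- La ## sdrop (Suc i) fib_word"
    by (metis i id_stake_snth_sdrop)
  then have "fib_word = subst_stream rhoF (?u @- La ## sdrop (Suc i) fib_word)"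
    using fib_word_fixed by metis
  \<comment> \<open>The block of the \<open>La\<close> at \<open>i\<close> is split: its first
    letter joins the prefix, so that its \<open>Lb\<close> comes right after, at position
    \<open>k\<close>.\<close>
  also have "\<dots> = (subst_word rhoF ?u @ [La]) @- Lb ## subst_stream rhoF (sdrop (Suc i) fib_word)"
    by (simp add: subst_stream_shift subst_stream_SCons rhoF_nonempty)
  finally obtain t where t: "fib_word = (subst_word rhoF ?u @ [La]) @- Lb ## t" ..
  have k: "k = length (subst_word rhoF ?u @ [La])"
    by (simp add: k_def length_subst_rhoF)
  show "fib_word !! k = Lb"
    by (subst t, subst k) (simp only: shift_snth_ge, simp)
  have "stake k fib_word = subst_word rhoF ?u @ [La]"
    by (subst t, subst k) (simp only: stake_shift, simp)
  then show "count_list (stake k fib_word) Lb = count_list ?u La"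
    by (simp add: count_b_subst_rhoF)
qed

text \<open>The prefix affects both letters alike: occurrence \<open>n\<close> is occurrence
  \<open>n - m\<close> of f moved by \<open>length u\<close>, and in f those positions differ by
  \<open>n - m\<close>.\<close>

lemma rdiff_shift_fib_word:
  assumes u: "count_list u La = m" "count_list u Lb = m" and n: "n > m"
  shows "rdiff (u @- fib_word) n = int n - int m"
proof -
  have inf: "infinite {i. fib_word !! i = La}"
    using infinite_letter_fib_word[of "[]"] by simp
  \<comment> \<open>This is the \<open>La\<close> of f with number \<open>n - m\<close>; by
    \<open>n > m\<close> the subtraction does not truncate.\<close>
  obtain i where i: "fib_word !! i = La" "count_list (stake i fib_word) La = n - Suc m"
    using ex_letter_pos[OF inf] by blast
  note b = fib_word_b_from_a[OF i(1), unfolded i(2)]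
  have stake: "stake (length u + j) (u @- fib_word) = u @ stake j fib_word" for j
    by (simp add: stake_shift)
  have nth: "(u @- fib_word) !! (length u + j) = fib_word !! j" for j
    by (simp add: shift_snth_ge)
  have "letter_pos La (u @- fib_word) n = length u + i"
    by (rule letter_pos_eqI[OF infinite_letter_fib_word]) (use i u n in \<open>simp_all add: stake nth\<close>)
  moreover have "letter_pos Lb (u @- fib_word) n = length u + Suc (i + (n - Suc m))"
  proof (rule letter_pos_eqI[OF infinite_letter_fib_word])
    show "(u @- fib_word) !! (length u + Suc (i + (n - Suc m))) = Lb"
      using b(1) by (simp only: nth)
    show "Suc (count_list (stake (length u + Suc (i + (n - Suc m))) (u @- fib_word)) Lb) = n"
      unfolding stake count_list_append b(2) using u n by simp
  qed
  ultimately show ?thesis using n by (simp add: rdiff_def of_nat_diff)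
qed

theorem theorem4p17:
  shows "(\<exists>!w. shd w = La \<and> (subst_stream rhoF' ^^ 2) w = w)
    \<and> (\<exists>!w. shd w = Lb \<and> (subst_stream rhoF' ^^ 2) w = w)
    \<and> word_tendsto (\<lambda>n. (subst_word rhoF' ^^ (2 * n)) [La]) ([La, Lb] @- fib_word)
    \<and> word_tendsto (\<lambda>n. (subst_word rhoF' ^^ (2 * n)) [Lb]) ([Lb, La] @- fib_word)
    \<and> rdiff ([La, Lb] @- fib_word) 1 = 1
    \<and> rdiff ([Lb, La] @- fib_word) 1 = - 1
    \<and> (\<forall>n>1. rdiff ([La, Lb] @- fib_word) n = int n - 1 \<and> rdiff ([Lb, La] @- fib_word) n = int n - 1)"
proof (intro conjI allI impI)
  show "\<exists>!w. shd w = La \<and> (subst_stream rhoF' ^^ 2) w = w"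
    by (rule ex1I[of _ "[La, Lb] @- fib_word"])
      (use rhoF'_sq_fixes_ab_fib rhoF'_sq_fixed_unique in auto)
  show "\<exists>!w. shd w = Lb \<and> (subst_stream rhoF' ^^ 2) w = w"
    by (rule ex1I[of _ "[Lb, La] @- fib_word"])
      (use rhoF'_sq_fixes_ba_fib rhoF'_sq_fixed_unique in auto)
  show "word_tendsto (\<lambda>n. (subst_word rhoF' ^^ (2 * n)) [La]) ([La, Lb] @- fib_word)"
    using rhoF'_sq_fixed_limit[OF rhoF'_sq_fixes_ab_fib] by simp
  show "word_tendsto (\<lambda>n. (subst_word rhoF' ^^ (2 * n)) [Lb]) ([Lb, La] @- fib_word)"
    using rhoF'_sq_fixed_limit[OF rhoF'_sq_fixes_ba_fib] by simp
  \<comment> \<open>The first occurrences lie inside the attached prefix, out of reach of the shift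
    argument, which needs \<open>n > 1\<close> here.\<close>
  have "letter_pos La ([La, Lb] @- fib_word) 1 = 0" "letter_pos Lb ([La, Lb] @- fib_word) 1 = 1"
    "letter_pos La ([Lb, La] @- fib_word) 1 = 1" "letter_pos Lb ([Lb, La] @- fib_word) 1 = 0"
    by (rule letter_pos_eqI[OF infinite_letter_fib_word]; simp)+
  then show "rdiff ([La, Lb] @- fib_word) 1 = 1" "rdiff ([Lb, La] @- fib_word) 1 = - 1"
    by (simp_all only: rdiff_def)
  fix n :: nat
  assume "n > 1"
  then show "rdiff ([La, Lb] @- fib_word) n = int n - 1" "rdiff ([Lb, La] @- fib_word) n = int n - 1"
    using rdiff_shift_fib_word[of "[La, Lb]" 1 n] rdiff_shift_fib_word[of "[Lb, La]" 1 n] by simp_all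
qed

end
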